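(* Fix a real number $q$ with $0<q<\frac12$. For each integer $n\ge 1$ let $$R_n(q)=1-(1-q)^n\sum_{m=0}^{n-1}\binom{n+m-1}{m}q^m+q^n\sum_{m=0}^{n-1}\binom{n+m-1}{m}(1-q)^m .$$ Then, as $n\to\infty$, $$R_n(q)=\frac{(4q(1-q))^n}{\sqrt{\pi}\,(1-2q)}\cdot\frac{1}{\sqrt n}\left(1+\frac{c_1(q)}{n}+\frac{c_2(q)}{n^2}+\frac{c_3(q)}{n^3}+\frac{c_4(q)}{n^4}+O\!\left(\frac1{n^5}\right)\right),$$ where $$c_1(q)=\frac{12q^2-12q-1}{8(2q-1)^2},\qquad c_2(q)=\frac{1}{128}\cdot\frac{400q^4-800q^3+120q^2+280q+1}{(2q-1)^4},$$ $$c_3(q)=\frac{5}{1024}\cdot\frac{1344q^6-4032q^5+112q^4+6496q^3-3444q^2-476q+1}{(2q-1)^6},$$ $$c_4(q)=\frac{21}{32768}\cdot\frac{20224q^8-80896q^7-88832q^6+549632q^5-514400q^4+18368q^3+92368q^2+3536q-1}{(2q-1)^8}.$$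
   Context: The implied constant in $O(\cdot)$ may depend on the fixed $q$. *)

theory Defs
  imports "HOL-Analysis.Analysis" "HOL-Library.Landau_Symbols"
begin

(* Only n >= 1 is meant: at n = 0 both sums are empty. For n >= 1 the natural-number
   subtraction n + m - 1 never truncates. *)
definition R :: "real \<Rightarrow> nat \<Rightarrow> real" where
  "R q n = 1 - (1 - q) ^ n * (\<Sum>m<n. real ((n + m - 1) choose m) * q ^ m)
             + q ^ n * (\<Sum>m<n. real ((n + m - 1) choose m) * (1 - q) ^ m)"

definition c1 :: "real \<Rightarrow> real" where
  "c1 q = (12 * q^2 - 12 * q - 1) / (8 * (2 * q - 1)^2)"

definition c2 :: "real \<Rightarrow> real" where
  "c2 q = 1 / 128 * ((400 * q^4 - 800 * q^3 + 120 * q^2 + 280 * q + 1) / (2 * q - 1)^4)"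

definition c3 :: "real \<Rightarrow> real" where
  "c3 q = 5 / 1024 *
     ((1344 * q^6 - 4032 * q^5 + 112 * q^4 + 6496 * q^3 - 3444 * q^2 - 476 * q + 1)
       / (2 * q - 1)^6)"

definition c4 :: "real \<Rightarrow> real" where
  "c4 q = 21 / 32768 *
     ((20224 * q^8 - 80896 * q^7 - 88832 * q^6 + 549632 * q^5 - 514400 * q^4
        + 18368 * q^3 + 92368 * q^2 + 3536 * q - 1)
       / (2 * q - 1)^8)"

end

theory Submission
  imports Defs "HOL-Real_Asymp.Real_Asymp"
begin

text \<open>
  Put \<open>z = 4 q (1 - q)\<close>, \<open>y = z / (1 - z)\<close> and \<open>a n = (2 n choose n) / 4 ^ n\<close>. Pascal's rule gives
  \<open>R q n - R q (n + 1) = (1 - 2 q) z ^ n a n\<close>, and \<open>0 \<le> R q n \<le> z ^ n\<close>. The inverse factorial series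
  \<open>S n = (\<Sum>k. (- y) ^ k (1/2)\<^sub>k / (n + 1)\<^sub>k)\<close>, with rising factorials, solves this recurrence formally in the
  form \<open>R q n = z ^ n a n S n / (1 - 2 q)\<close>. Truncating \<open>S\<close> after five terms leaves an explicit defect
  of order \<open>z ^ n a n / n ^ 5\<close> in the recurrence, which sums geometrically. The same
  difference argument, started from Wallis's product, expands \<open>a n * sqrt (pi n)\<close>, and multiplying the
  two expansions in \<open>1 / n\<close> yields the coefficients.
\<close>

section \<open>Asymptotic tools\<close>

text \<open>A Stolz-Cesaro argument for null sequences: telescoping the bound on the differences
  from \<open>n\<close> to \<open>n + k\<close> and letting \<open>k\<close> tend to infinity
  removes both far ends.\<close>

lemma bigo_from_differences:
  fixes f g :: "nat \<Rightarrow> real"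
  assumes f: "f \<longlonglongrightarrow> 0" and g: "g \<longlonglongrightarrow> 0"
    and mono: "eventually (\<lambda>n. g (Suc n) \<le> g n) sequentially"
    and diff: "(\<lambda>n. f n - f (Suc n)) \<in> O(\<lambda>n. g n - g (Suc n))"
  shows "f \<in> O(g)"
proof -
  obtain c where c: "c > 0" "eventually (\<lambda>n. norm (f n - f (Suc n)) \<le> c * norm (g n - g (Suc n))) sequentially"
    using diff by (elim landau_o.bigE)
  \<comment> \<open>Monotonicity of \<open>g\<close> drops the norm on the right, so that the bounds
    telescope.\<close>
  from eventually_conj[OF c(2) mono]
  obtain n0 where n0: "\<And>n. n \<ge> n0 \<Longrightarrow> \<bar>f n - f (Suc n)\<bar> \<le> c * (g n - g (Suc n))"
    unfolding eventually_sequentially by fastforce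
  have bound: "\<bar>f n\<bar> \<le> c * g n" if n: "n \<ge> n0" for n
  proof -
    have tel: "\<bar>f n\<bar> \<le> \<bar>f (n + k)\<bar> + c * (g n - g (n + k))" for k
    proof (induction k)
      case (Suc k)
      have "\<bar>f (n + k)\<bar> \<le> \<bar>f (n + Suc k)\<bar> + c * (g (n + k) - g (n + Suc k))"
        using n0[of "n + k"] n by (simp add: abs_le_iff) linarith
      with Suc show ?case by (simp add: algebra_simps)
    qed simp
    have "(\<lambda>k. \<bar>f (k + n)\<bar> + c * (g n - g (k + n))) \<longlonglongrightarrow> \<bar>0\<bar> + c * (g n - 0)"
      by (intro tendsto_intros LIMSEQ_ignore_initial_segment f g)
    then have "(\<lambda>k. \<bar>f (n + k)\<bar> + c * (g n - g (n + k))) \<longlonglongrightarrow> c * g n"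
      by (simp add: add.commute)
    then show ?thesis
      using tel by (intro LIMSEQ_le_const) auto
  qed
  show ?thesis
  proof (rule landau_o.bigI[OF c(1)])
    show "eventually (\<lambda>n. norm (f n) \<le> c * norm (g n)) sequentially"
      using eventually_ge_at_top[of n0]
    proof eventually_elim
      case (elim n)
      have "c * g n \<le> c * \<bar>g n\<bar>" using c(1) by simp
      with bound[OF elim] show ?case by simp
    qed
  qed
qed

lemma poly_inverse_nat_bigo: "(\<lambda>n. poly p (1 / real n)) \<in> O(\<lambda>_. 1)"
proof -
  have "(\<lambda>n. poly p (1 / real n)) \<longlonglongrightarrow> poly p 0"
    by (intro tendsto_poly lim_1_over_n)
  then show ?thesis by (intro bigoI_tendsto[where c = "poly p 0"]) auto
qed

lemma poly_inverse_nat_bigo_pow: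
  "(\<lambda>n. (1 / real n) ^ k * poly p (1 / real n)) \<in> O(\<lambda>n. 1 / real n ^ k)"
  using landau_o.big.mult[OF landau_o.big_refl poly_inverse_nat_bigo, of "\<lambda>n. (1 / real n) ^ k" p]
  by (simp add: power_one_over)

section \<open>The central binomial coefficient\<close>

definition cbin :: "nat \<Rightarrow> real" where
  "cbin n = real ((2 * n) choose n) / 4 ^ n"

lemma cbin_pos: "cbin n > 0"
  by (simp add: cbin_def)

lemma cbin_Suc: "cbin (Suc n) = (2 * real n + 1) / (2 * real n + 2) * cbin n"
proof -
  have "Suc n * ((2 * Suc n) choose Suc n) = (2 * Suc n) * (Suc (2 * n) choose n)"
    using Suc_times_binomial_eq[of "Suc (2 * n)" n] by (simp add: mult.commute)
  moreover have "Suc n * (Suc (2 * n) choose n) = Suc (2 * n) * ((2 * n) choose n)"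
    using Suc_times_binomial_eq[of "2 * n" n] binomial_symmetric[of n "Suc (2 * n)"]
    by (simp add: mult.commute Suc_diff_le)
  ultimately have "Suc n * ((2 * Suc n) choose Suc n) = 2 * (Suc (2 * n) * ((2 * n) choose n))"
    by (simp only: mult.assoc)
  then have "real (Suc n) * real ((2 * Suc n) choose Suc n) = 2 * (real (Suc (2 * n)) * real ((2 * n) choose n))"
    by (metis of_nat_mult of_nat_numeral)
  moreover have "a / (4 * p) = (2 * x + 1) / (2 * x + 2) * (c / p)"
    if "(x + 1) * a = 2 * ((2 * x + 1) * c)" "x \<ge> 0" for a c p x :: real
  proof -
    have a: "a = 2 * ((2 * x + 1) * c) / (x + 1)"
      using that by (simp add: nonzero_eq_divide_eq mult.commute)
    have "(2 * x + 1) / (2 * x + 2) = (2 * x + 1) / (x + 1) / 2"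
      using that by (simp add: field_simps)
    then show ?thesis by (simp add: a mult.commute)
  qed
  ultimately show ?thesis
    unfolding cbin_def power_Suc by (simp only: of_nat_Suc of_nat_mult of_nat_numeral add.commute of_nat_0_le_iff)
qed

lemma cbin_le_1: "cbin n \<le> 1"
proof (induction n)
  case (Suc n)
  have "(2 * real n + 1) / (2 * real n + 2) * cbin n \<le> 1 * 1"
    by (intro mult_mono Suc) (auto simp: field_simps cbin_pos less_imp_le)
  then show ?case by (simp add: cbin_Suc)
qed (simp add: cbin_def)

text \<open>Each factor is \<open>(2 * k)^2 / ((2 * k - 1) * (2 * k + 1))\<close>, which is what
  \<open>cbin_Suc\<close>, squared, contributes together with the shift of \<open>2 * n + 1\<close>.
  Wallis's limit thus becomes a statement about \<open>cbin\<close>.\<close>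

lemma cbin_wallis: "(\<Prod>k=1..n. (4 * real k ^ 2) / (4 * real k ^ 2 - 1)) = 1 / (cbin n ^ 2 * (2 * real n + 1))"
proof (induction n)
  case (Suc n)
  have e: "4 * (real (Suc n))\<^sup>2 - 1 = (2 * real n + 1) * (2 * real n + 3)"
    by (simp add: power2_eq_square algebra_simps)
  have *: "1 / (c ^ 2 * (2 * x + 1)) * (4 * (x + 1) ^ 2 / ((2 * x + 1) * (2 * x + 3)))
      = 1 / (((2 * x + 1) / (2 * x + 2) * c) ^ 2 * (2 * (x + 1) + 1))" if "c > 0" "x \<ge> 0" for c x :: real
  proof -
    have "2 * x + 2 = 2 * (x + 1)" "2 * (x + 1) + 1 = 2 * x + 3" by simp_all
    moreover have "2 * x + 1 \<noteq> 0" "2 * x + 3 \<noteq> 0" "x + 1 \<noteq> 0" using that by simp_all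
    ultimately show ?thesis
      using that(1) by (simp only:) (simp add: power_mult_distrib power_divide field_simps power2_eq_square)
  qed
  have "(\<Prod>k=1..Suc n. (4 * real k ^ 2) / (4 * real k ^ 2 - 1))
      = (\<Prod>k=1..n. (4 * real k ^ 2) / (4 * real k ^ 2 - 1)) * (4 * real (Suc n) ^ 2 / (4 * real (Suc n) ^ 2 - 1))"
    by simp
  also have "\<dots> = 1 / (cbin (Suc n) ^ 2 * (2 * real (Suc n) + 1))"
    unfolding Suc e cbin_Suc using *[OF cbin_pos[of n], of "real n"] by (simp add: add.commute)
  finally show ?case .
qed (simp add: cbin_def)

lemma cbin_sqrt_tendsto: "(\<lambda>n. cbin n * sqrt (pi * real n)) \<longlonglongrightarrow> 1"
proof -
  have "(\<lambda>n. 1 / (cbin n ^ 2 * (2 * real n + 1))) \<longlonglongrightarrow> pi / 2"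
    using wallis by (simp only: cbin_wallis)
  moreover have "(\<lambda>n. pi * real n / (2 * real n + 1)) \<longlonglongrightarrow> pi / 2"
    by real_asymp
  \<comment> \<open>Both sequences tend to \<open>pi / 2\<close>; their quotient is
    \<open>cbin n ^ 2 * (pi * real n)\<close>.\<close>
  ultimately have "(\<lambda>n. sqrt ((pi * real n / (2 * real n + 1)) / (1 / (cbin n ^ 2 * (2 * real n + 1)))))
      \<longlonglongrightarrow> sqrt ((pi / 2) / (pi / 2))"
    by (intro tendsto_real_sqrt tendsto_divide[where a = "pi / 2" and b = "pi / 2"]) simp_all
  moreover have "sqrt ((pi * real n / (2 * real n + 1)) / (1 / (cbin n ^ 2 * (2 * real n + 1))))
      = cbin n * sqrt (pi * real n)" for n
  proof -
    have "2 * real n + 1 \<noteq> 0" by linarith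
    then have "(pi * real n / (2 * real n + 1)) / (1 / (cbin n ^ 2 * (2 * real n + 1)))
        = cbin n ^ 2 * (pi * real n)" by (simp add: field_simps)
    then show ?thesis
      using cbin_pos[of n] by (simp add: real_sqrt_mult)
  qed
  ultimately show ?thesis by simp
qed

section \<open>Expansion of the central binomial coefficient in powers of
  \<open>1 / n\<close>\<close>

definition stirling_poly :: "real poly" where
  "stirling_poly = [:1, - 1 / 8, 1 / 128, 5 / 1024, - 21 / 32768:]"

text \<open>The quotient of both sides changes by a relative \<open>O(1 / n ^ 6)\<close> from \<open>n\<close> to \<open>n + 1\<close>, and it
  tends to 1 by Wallis's product.\<close>

lemma cbin_expansion:
  "(\<lambda>n. cbin n * sqrt (pi * real n) - poly stirling_poly (1 / real n)) \<in> O(\<lambda>n. 1 / real n ^ 5)"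
proof -
  define Q where "Q = (\<lambda>n. poly stirling_poly (1 / real n))"
  define u where "u = (\<lambda>n. cbin n * sqrt (pi * real n) / Q n)"
  \<comment> \<open>For large \<open>n\<close> this is the ratio of \<open>u (Suc n)\<close> to
    \<open>u n\<close>.\<close>
  define rho where "rho = (\<lambda>n. (2 * real n + 1) / (2 * real n + 2) * sqrt ((real n + 1) / real n)
      * (Q n / Q (Suc n)))"
  have Q_eq: "Q n = 1 - 1 / 8 * (1 / real n) + 1 / 128 * (1 / real n) ^ 2 + 5 / 1024 * (1 / real n) ^ 3
      - 21 / 32768 * (1 / real n) ^ 4" for n
    unfolding Q_def stirling_poly_def by (simp add: algebra_simps power2_eq_square eval_nat_numeral)
  have Q1: "Q \<longlonglongrightarrow> 1" unfolding Q_eq by real_asymp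
  have Qpos: "eventually (\<lambda>n. Q n > 0) sequentially"
    using order_tendstoD(1)[OF Q1, of 0] by simp
  have u1: "u \<longlonglongrightarrow> 1"
    unfolding u_def using tendsto_divide[OF cbin_sqrt_tendsto Q1] by simp
  have QSuc1: "(\<lambda>n. Q (Suc n)) \<longlonglongrightarrow> 1"
    using Q1 by (rule LIMSEQ_Suc)
  have QSuc_pos: "eventually (\<lambda>n. Q (Suc n) > 0) sequentially"
    using order_tendstoD(1)[OF QSuc1, of 0] by simp
  \<comment> \<open>\<open>W\<close> is the numerator of \<open>1 - rho n ^ 2\<close>; squaring
    removes the root, leaving a rational function of \<open>n\<close>. The coefficients of
    \<open>stirling_poly\<close> are those that cancel all orders of \<open>W\<close> above
    \<open>1 / n ^ 4\<close>.\<close>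
  define W where "W = (\<lambda>n. 4 * real n * (real n + 1) * Q (Suc n) ^ 2 - (2 * real n + 1) ^ 2 * Q n ^ 2)"
  have W: "W \<in> O(\<lambda>n. 1 / real n ^ 4)"
    unfolding W_def Q_eq by real_asymp
  have "(\<lambda>n. 1 / (Q (Suc n)) ^ 2) \<longlonglongrightarrow> 1 / 1 ^ 2"
    by (intro tendsto_intros QSuc1) auto
  then have "(\<lambda>n. 1 / (Q (Suc n)) ^ 2) \<in> O(\<lambda>_. 1)"
    by (intro bigoI_tendsto[where c = 1]) auto
  from landau_o.big.mult[OF W this]
  have "(\<lambda>n. 1 / (4 * real n * (real n + 1)) * (W n * (1 / (Q (Suc n)) ^ 2)))
      \<in> O(\<lambda>n. 1 / (4 * real n * (real n + 1)) * (1 / real n ^ 4))"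
    by (intro landau_o.big.mult_left) simp
  \<comment> \<open>Both sides have exact order \<open>1 / n ^ 6\<close>, which makes
    \<open>1 / n ^ 5\<close> the right comparison sequence.\<close>
  also have "(\<lambda>n. 1 / (4 * real n * (real n + 1)) * (1 / real n ^ 4))
      \<in> O(\<lambda>n. 1 / real n ^ 5 - 1 / real (Suc n) ^ 5)"
    by real_asymp
  finally have WQ: "(\<lambda>n. 1 / (4 * real n * (real n + 1)) * (W n * (1 / (Q (Suc n)) ^ 2)))
      \<in> O(\<lambda>n. 1 / real n ^ 5 - 1 / real (Suc n) ^ 5)" .
  have "(\<lambda>n. 1 - rho n) \<in> O(\<lambda>n. 1 / (4 * real n * (real n + 1)) * (W n * (1 / (Q (Suc n)) ^ 2)))"
  proof (rule landau_o.bigI[of 1])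
    show "eventually (\<lambda>n. norm (1 - rho n)
        \<le> 1 * norm (1 / (4 * real n * (real n + 1)) * (W n * (1 / (Q (Suc n)) ^ 2)))) sequentially"
      using Qpos QSuc_pos eventually_gt_at_top[of 0]
    proof eventually_elim
      case (elim n)
      have "rho n \<ge> 0" unfolding rho_def using elim by simp
      have "rho n ^ 2 = ((2 * real n + 1) / (2 * real n + 2)) ^ 2 * ((real n + 1) / real n) * (Q n / Q (Suc n)) ^ 2"
        unfolding rho_def power_mult_distrib by simp
      also have "((2 * real n + 1) / (2 * real n + 2)) ^ 2 * ((real n + 1) / real n)
          = (2 * real n + 1) ^ 2 / (4 * real n * (real n + 1))"
      proof -
        have "(2 * real n + 2) ^ 2 = 4 * (real n + 1) * (real n + 1)"
          by (simp add: power2_eq_square algebra_simps)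
        then show ?thesis by (simp add: power_divide)
      qed
      finally have "1 - rho n ^ 2 = 1 / (4 * real n * (real n + 1)) * (W n * (1 / (Q (Suc n)) ^ 2))"
        unfolding W_def using elim by (simp add: power_divide diff_divide_distrib left_diff_distrib)
      moreover have "\<bar>1 - rho n\<bar> * 1 \<le> \<bar>1 - rho n\<bar> * \<bar>1 + rho n\<bar>"
        using \<open>rho n \<ge> 0\<close> by (intro mult_left_mono) auto
      moreover have "\<bar>1 - rho n\<bar> * \<bar>1 + rho n\<bar> = \<bar>1 - rho n ^ 2\<bar>"
        by (simp add: abs_mult[symmetric] power2_eq_square algebra_simps)
      ultimately show ?case by simp
    qed
  qed simp
  from landau_o.big_trans[OF this WQ]
  have rho1: "(\<lambda>n. 1 - rho n) \<in> O(\<lambda>n. 1 / real n ^ 5 - 1 / real (Suc n) ^ 5)" .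
  have step: "eventually (\<lambda>n. u n - u (Suc n) = u n * (1 - rho n)) sequentially"
    using Qpos eventually_gt_at_top[of 0]
  proof eventually_elim
    case (elim n)
    have "sqrt (pi * real (Suc n)) = sqrt (pi * real n) * sqrt ((real n + 1) / real n)"
      using elim by (simp add: real_sqrt_mult[symmetric] field_simps)
    then have "u (Suc n) = u n * rho n"
      using elim unfolding u_def rho_def cbin_Suc by simp
    then show ?case by (simp add: algebra_simps)
  qed
  have "u \<in> O(\<lambda>_. 1)"
    using u1 by (intro bigoI_tendsto[where c = 1]) auto
  from landau_o.big.mult[OF this rho1]
  have "(\<lambda>n. (u n - 1) - (u (Suc n) - 1)) \<in> O(\<lambda>n. 1 / real n ^ 5 - 1 / real (Suc n) ^ 5)"
    using landau_o.big.in_cong[OF step] by simp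
  moreover have "(\<lambda>n. u n - 1) \<longlonglongrightarrow> 0"
    using tendsto_diff[OF u1 tendsto_const[of 1]] by simp
  moreover have "(\<lambda>n. 1 / real n ^ 5) \<longlonglongrightarrow> 0" by real_asymp
  moreover have "eventually (\<lambda>n. 1 / real (Suc n) ^ 5 \<le> 1 / real n ^ 5) sequentially"
    by real_asymp
  ultimately have uO: "(\<lambda>n. u n - 1) \<in> O(\<lambda>n. 1 / real n ^ 5)"
    by (intro bigo_from_differences[of "\<lambda>n. u n - 1" "\<lambda>n. 1 / real n ^ 5"])
  have QO: "Q \<in> O(\<lambda>_. 1)"
    using Q1 by (intro bigoI_tendsto[where c = 1]) auto
  \<comment> \<open>Multiplying by the bounded \<open>Q\<close> turns the relative error into the
    absolute one.\<close>
  have "(\<lambda>n. Q n * (u n - 1)) \<in> O(\<lambda>n. 1 / real n ^ 5)"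
    using landau_o.big.mult[OF QO uO] by simp
  moreover have "eventually (\<lambda>n. Q n * (u n - 1) = cbin n * sqrt (pi * real n) - Q n) sequentially"
    using Qpos by eventually_elim (simp add: u_def field_simps)
  ultimately show ?thesis
    using landau_o.big.in_cong[of "\<lambda>n. Q n * (u n - 1)"] unfolding Q_def by simp
qed

section \<open>The recurrence for \<open>R\<close>\<close>

text \<open>The binomial series of \<open>1 / (1 - x) ^ n\<close>, cut off after \<open>n\<close>
  terms.\<close>

definition nbsum :: "real \<Rightarrow> nat \<Rightarrow> real" where
  "nbsum x n = (\<Sum>m<n. real ((n + m - 1) choose m) * x ^ m)"

lemma R_nbsum: "R q n = 1 - (1 - q) ^ n * nbsum q n + q ^ n * nbsum (1 - q) n"
  by (simp add: R_def nbsum_def)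

text \<open>Pascal's rule splits the shifted sum into \<open>x\<close> times itself, without its top
  term, and the sum for \<open>n\<close> with one extra term. The two border terms involve
  \<open>(2 * n) choose n\<close> and half of it, hence the factor \<open>1 / 2 - x\<close>.\<close>

lemma nbsum_Suc:
  assumes "n \<ge> 1"
  shows "(1 - x) * nbsum x (Suc n) = nbsum x n + (1 / 2 - x) * (4 * x) ^ n * cbin n"
proof -
  obtain k where k: "n = Suc k" using assms by (cases n) auto
  have F: "nbsum x (Suc n) = (\<Sum>j<n. real ((n + j) choose j) * x ^ j) + real ((2 * n) choose n) * x ^ n"
    by (simp add: nbsum_def mult_2)
  have "nbsum x (Suc n) = 1 + (\<Sum>j<n. real (Suc (n + j) choose Suc j) * x ^ Suc j)"
    unfolding nbsum_def by (subst sum.lessThan_Suc_shift) simp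
  also have "\<dots> = x * (\<Sum>j<n. real ((n + j) choose j) * x ^ j)
      + (1 + (\<Sum>j<n. real ((n + j) choose Suc j) * x ^ Suc j))"
    by (simp add: algebra_simps sum.distrib sum_distrib_left)
  also have "1 + (\<Sum>j<n. real ((n + j) choose Suc j) * x ^ Suc j)
      = (\<Sum>m<Suc n. real ((n + m - 1) choose m) * x ^ m)"
    by (subst sum.lessThan_Suc_shift) simp
  also have "\<dots> = nbsum x n + real ((2 * n - 1) choose n) * x ^ n"
    by (simp add: nbsum_def mult_2)
  also have "real ((2 * n - 1) choose n) = real ((2 * n) choose n) / 2"
  proof -
    have "(2 * n) choose n = (Suc (2 * k) choose k) + (Suc (2 * k) choose Suc k)"
      by (simp add: k)
    moreover have "Suc (2 * k) choose k = Suc (2 * k) choose Suc k"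
      by (subst binomial_symmetric) auto
    ultimately show ?thesis by (simp add: k)
  qed
  also have "(\<Sum>j<n. real ((n + j) choose j) * x ^ j) = nbsum x (Suc n) - (4 * x) ^ n * cbin n"
    using F by (simp add: cbin_def power_mult_distrib)
  finally have "nbsum x (Suc n) = x * (nbsum x (Suc n) - (4 * x) ^ n * cbin n)
      + (nbsum x n + (4 * x) ^ n * cbin n / 2)"
    by (simp add: cbin_def power_mult_distrib mult.commute)
  then show ?thesis
    by (simp add: algebra_simps)
qed

text \<open>Passing from \<open>n\<close> to \<open>n + 1\<close> adds border terms with opposite
  factors \<open>1 / 2 - x\<close> and \<open>x - 1 / 2\<close> and the same power of
  \<open>4 * x * (1 - x)\<close>, so they cancel. For \<open>0 < x < 1\<close> it says that in
  independent trials exactly one of two outcomes is the first to occur \<open>n\<close>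
  times.\<close>

lemma nbsum_complementary:
  assumes "n \<ge> 1"
  shows "(1 - x) ^ n * nbsum x n + x ^ n * nbsum (1 - x) n = 1"
  using assms
proof (induction n rule: dec_induct)
  case (step n)
  have "(1 - x) ^ Suc n * nbsum x (Suc n) + x ^ Suc n * nbsum (1 - x) (Suc n)
      = (1 - x) ^ n * ((1 - x) * nbsum x (Suc n)) + x ^ n * ((1 - (1 - x)) * nbsum (1 - x) (Suc n))"
    by simp
  also have "\<dots> = (1 - x) ^ n * nbsum x n + x ^ n * nbsum (1 - x) n"
  proof -
    have e: "(1 - x) ^ n * (4 * x) ^ n = x ^ n * (4 * (1 - x)) ^ n"
      unfolding power_mult_distrib[symmetric] by (simp add: mult_ac)
    have "(1 - x) ^ n * (nbsum x n + (1 / 2 - x) * (4 * x) ^ n * cbin n)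
        + x ^ n * (nbsum (1 - x) n + (1 / 2 - (1 - x)) * (4 * (1 - x)) ^ n * cbin n)
      = (1 - x) ^ n * nbsum x n + x ^ n * nbsum (1 - x) n
        + (1 / 2 - x) * cbin n * ((1 - x) ^ n * (4 * x) ^ n - x ^ n * (4 * (1 - x)) ^ n)"
      by (simp only: ring_distribs) simp
    then show ?thesis
      unfolding nbsum_Suc[OF step(1)] e by simp
  qed
  finally show ?case using step by simp
qed (simp add: nbsum_def)

lemma R_eq: "n \<ge> 1 \<Longrightarrow> R q n = 2 * q ^ n * nbsum (1 - q) n"
  using nbsum_complementary[of n q] by (simp add: R_nbsum)

lemma R_Suc:
  assumes "n \<ge> 1"
  shows "R q n - R q (Suc n) = (1 - 2 * q) * (4 * q * (1 - q)) ^ n * cbin n"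
proof -
  \<comment> \<open>The extra factor \<open>q\<close> is the \<open>1 - x\<close> of
    \<open>nbsum_Suc\<close> at \<open>x = 1 - q\<close>.\<close>
  have "R q (Suc n) = 2 * q ^ n * ((1 - (1 - q)) * nbsum (1 - q) (Suc n))"
    by (simp add: R_eq)
  also have "\<dots> = R q n + 2 * q ^ n * ((1 / 2 - (1 - q)) * (4 * (1 - q)) ^ n * cbin n)"
    unfolding nbsum_Suc[OF assms] R_eq[OF assms] by (simp add: algebra_simps)
  finally have "R q n - R q (Suc n) = (1 - 2 * q) * (q ^ n * (4 * (1 - q)) ^ n) * cbin n"
    by (simp add: algebra_simps)
  then show ?thesis
    unfolding power_mult_distrib[symmetric] by (simp add: mult_ac)
qed

text \<open>At \<open>x = 1 / 2\<close> the complementary sums coincide, which evaluates the dominating sum.\<close>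

lemma R_bounds:
  assumes q: "0 < q" "q < 1 / 2" and n: "n \<ge> 1"
  shows "0 \<le> R q n" "R q n \<le> (4 * q * (1 - q)) ^ n"
proof -
  have half: "2 * nbsum (1 / 2) n = 2 ^ n"
    using nbsum_complementary[OF n, of "1 / 2"] by (simp add: field_simps)
  have "nbsum (1 - q) n \<le> (\<Sum>m<n. (2 * (1 - q)) ^ n * (real ((n + m - 1) choose m) * (1 / 2) ^ m))"
    unfolding nbsum_def
  proof (rule sum_mono)
    fix m assume m: "m \<in> {..<n}"
    \<comment> \<open>As \<open>2 * (1 - q) \<ge> 1\<close> and \<open>m < n\<close>, the exponent
      of this factor can be raised to \<open>n\<close>.\<close>
    have "(1 - q) ^ m = (2 * (1 - q)) ^ m * (1 / 2) ^ m"
      by (simp add: power_mult_distrib[symmetric] diff_divide_distrib)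
    also have "\<dots> \<le> (2 * (1 - q)) ^ n * (1 / 2) ^ m"
      using m q by (intro mult_right_mono power_increasing) auto
    finally have "real ((n + m - 1) choose m) * (1 - q) ^ m
        \<le> real ((n + m - 1) choose m) * ((2 * (1 - q)) ^ n * (1 / 2) ^ m)"
      by (rule mult_left_mono) simp
    then show "real ((n + m - 1) choose m) * (1 - q) ^ m
        \<le> (2 * (1 - q)) ^ n * (real ((n + m - 1) choose m) * (1 / 2) ^ m)"
      by (simp add: mult_ac)
  qed
  also have "\<dots> = (2 * (1 - q)) ^ n * nbsum (1 / 2) n"
    by (simp add: nbsum_def sum_distrib_left)
  finally have "2 * q ^ n * nbsum (1 - q) n \<le> 2 * q ^ n * ((2 * (1 - q)) ^ n * nbsum (1 / 2) n)"
    using q by (intro mult_left_mono) auto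
  also have "\<dots> = q ^ n * (2 * (1 - q)) ^ n * 2 ^ n"
    using half by simp
  also have "\<dots> = (4 * q * (1 - q)) ^ n"
  proof -
    have "q * (2 * (1 - q)) * 2 = 4 * q * (1 - q)" by simp
    then show ?thesis by (simp only: power_mult_distrib[symmetric])
  qed
  finally show "R q n \<le> (4 * q * (1 - q)) ^ n"
    by (simp add: R_eq[OF n])
  show "0 \<le> R q n"
    unfolding R_eq[OF n] nbsum_def using q by (intro mult_nonneg_nonneg sum_nonneg) auto
qed

section \<open>The inverse factorial series\<close>

text \<open>The coefficient of \<open>x ^ k\<close> in the hypergeometric series
  \<open>2F1(1, 1/2; n + 1; x)\<close>.\<close>

definition ifac :: "nat \<Rightarrow> nat \<Rightarrow> real" where
  "ifac k n = pochhammer (1 / 2) k / pochhammer (real n + 1) k"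

lemma ifac_values:
  "ifac 0 n = 1"
  "ifac 1 n = 1 / 2 / (real n + 1)"
  "ifac 2 n = 3 / 4 / ((real n + 1) * (real n + 2))"
  "ifac 3 n = 15 / 8 / ((real n + 1) * (real n + 2) * (real n + 3))"
  "ifac 4 n = 105 / 16 / ((real n + 1) * (real n + 2) * (real n + 3) * (real n + 4))"
  "ifac 5 n = 945 / 32 / ((real n + 1) * (real n + 2) * (real n + 3) * (real n + 4) * (real n + 5))"
  by (simp_all add: ifac_def numeral_eq_Suc pochhammer_Suc add.assoc)

lemma ifac_Suc_left: "ifac (Suc k) n = ifac k n * ((1 / 2 + real k) / (real n + 1 + real k))"
  by (simp add: ifac_def pochhammer_Suc)

text \<open>The factor on the left is \<open>cbin (Suc n) / cbin n\<close>, so a step in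
  \<open>n\<close> turns into a difference in \<open>k\<close>. The reason is that
  \<open>pochhammer (real n + 1) (Suc k)\<close> can be split at its first or at its last
  factor.\<close>

lemma ifac_Suc_right:
  "(2 * real n + 1) / (2 * real n + 2) * ifac k (Suc n) = ifac k n - ifac (Suc k) n"
proof -
  have "(real n + 1) * pochhammer (real n + 2) k = pochhammer (real n + 1) k * (real n + 1 + real k)"
    using pochhammer_rec[of "real n + 1" k] pochhammer_rec'[of "real n + 1" k]
    by (simp add: add.commute mult.commute)
  then have "pochhammer (real n + 2) k = pochhammer (real n + 1) k * (real n + 1 + real k) / (real n + 1)"
    by (simp add: nonzero_eq_divide_eq mult.commute)
  moreover have "real (Suc n) + 1 = real n + 2" by simp
  ultimately have "ifac k (Suc n) = ifac k n * ((real n + 1) / (real n + 1 + real k))"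
    unfolding ifac_def by (simp only: times_divide_times_eq divide_divide_eq_right)
  then show ?thesis
    unfolding ifac_Suc_left
  proof -
    assume *: "ifac k (Suc n) = ifac k n * ((real n + 1) / (real n + 1 + real k))"
    have "(2 * real n + 1) / (2 * real n + 2) * ((real n + 1) / (real n + 1 + real k))
        = 1 - (1 / 2 + real k) / (real n + 1 + real k)"
    proof -
      have "(2 * real n + 1) / (2 * real n + 2) = (1 / 2 + real n) / (real n + 1)"
        by (simp add: field_simps)
      then have "(2 * real n + 1) / (2 * real n + 2) * ((real n + 1) / (real n + 1 + real k))
          = (1 / 2 + real n) / (real n + 1 + real k)"
        by simp
      also have "\<dots> = 1 - (1 / 2 + real k) / (real n + 1 + real k)"
        using add_pos_nonneg[of "real n + 1" "real k"] by (simp add: field_simps)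
      finally show ?thesis .
    qed
    then show "(2 * real n + 1) / (2 * real n + 2) * ifac k (Suc n)
        = ifac k n - ifac k n * ((1 / 2 + real k) / (real n + 1 + real k))"
      unfolding * by (metis mult.left_commute mult.right_neutral right_diff_distrib)
  qed
qed

text \<open>Truncation is essential: the full series diverges for \<open>y > 1\<close>, which occurs
  for \<open>q\<close> near \<open>1 / 2\<close>.\<close>

definition ifac_sum :: "real \<Rightarrow> nat \<Rightarrow> nat \<Rightarrow> real" where
  "ifac_sum y K n = (\<Sum>k<K. (- y) ^ k * ifac k n)"

text \<open>The recurrence for \<open>R\<close>, divided by
  \<open>(1 - 2 * q) ^ 2 * z ^ n * cbin n / (1 - 2 * q)\<close>, asks this left side to vanish. By
  \<open>ifac_Suc_right\<close> the terms telescope, and only the first omitted one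
  survives.\<close>

lemma ifac_sum_defect:
  "1 - (1 + y) * ifac_sum y K n + y * ((2 * real n + 1) / (2 * real n + 2)) * ifac_sum y K (Suc n)
    = (- y) ^ K * ifac K n"
proof (induction K)
  case (Suc K)
  have "1 - (1 + y) * ifac_sum y (Suc K) n + y * ((2 * real n + 1) / (2 * real n + 2)) * ifac_sum y (Suc K) (Suc n)
    = (1 - (1 + y) * ifac_sum y K n + y * ((2 * real n + 1) / (2 * real n + 2)) * ifac_sum y K (Suc n))
      - (1 + y) * (- y) ^ K * ifac K n
      + y * (- y) ^ K * ((2 * real n + 1) / (2 * real n + 2) * ifac K (Suc n))"
    unfolding ifac_sum_def by (simp only: sum.lessThan_Suc) (simp add: ring_distribs mult_ac)
  also have "\<dots> = (- y) ^ Suc K * ifac (Suc K) n"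
    unfolding Suc ifac_Suc_right by (simp add: algebra_simps)
  finally show ?case .
qed (simp add: ifac_sum_def ifac_def)

text \<open>The error \<open>f\<close> of the approximation has differences given by the defect, of
  order \<open>G\<close>. Since \<open>G\<close> decays geometrically, it is comparable with its own
  differences, so \<open>bigo_from_differences\<close> yields \<open>f \<in> O(G)\<close>.\<close>

lemma R_ifac_expansion:
  assumes q: "0 < q" "q < 1 / 2"
  defines "z \<equiv> 4 * q * (1 - q)" and "y \<equiv> 4 * q * (1 - q) / (1 - 2 * q) ^ 2"
  shows "(\<lambda>n. R q n * (1 - 2 * q) / (z ^ n * cbin n) - ifac_sum y 5 n) \<in> O(\<lambda>n. 1 / real n ^ 5)"
proof -
  define G where "G = (\<lambda>n. z ^ n * cbin n / real n ^ 5)"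
  define f where "f = (\<lambda>n. R q n - z ^ n * cbin n * ifac_sum y 5 n / (1 - 2 * q))"
  define D where "D = (1 - 2 * q) * (- y) ^ 5"
  have z1: "1 - z = (1 - 2 * q) ^ 2"
    unfolding z_def by (simp add: power2_eq_square algebra_simps)
  have z: "0 < z" "z < 1"
  proof -
    show "0 < z" using q by (simp add: z_def)
    have "0 < (1 - 2 * q) ^ 2" using q by simp
    with z1 show "z < 1" by linarith
  qed
  have yz: "1 + y = 1 / (1 - 2 * q) ^ 2" "y = z / (1 - 2 * q) ^ 2"
    using q z1 by (auto simp: y_def z_def field_simps)
  have zn: "(\<lambda>n. z ^ n) \<longlonglongrightarrow> 0" using z by (intro LIMSEQ_power_zero) auto
  have bounded: "(\<lambda>n. z ^ n * cbin n * h n) \<longlonglongrightarrow> 0" if h: "h \<longlonglongrightarrow> c" for h :: "nat \<Rightarrow> real" and c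
  proof -
    have "(\<lambda>n. z ^ n * cbin n) \<longlonglongrightarrow> 0"
    proof (rule tendsto_sandwich[OF _ _ tendsto_const zn])
      show "eventually (\<lambda>n. 0 \<le> z ^ n * cbin n) sequentially"
        using z cbin_pos by (intro always_eventually allI) (simp add: less_imp_le)
      show "eventually (\<lambda>n. z ^ n * cbin n \<le> z ^ n) sequentially"
        using z cbin_le_1 by (intro always_eventually allI mult_left_le) (auto simp: less_imp_le)
    qed
    from tendsto_mult[OF this h] show ?thesis by simp
  qed
  have ifac5: "(\<lambda>n. ifac 5 n) \<in> O(\<lambda>n. 1 / real n ^ 5)"
    unfolding ifac_values by real_asymp
  have S: "(\<lambda>n. ifac_sum y 5 n) \<longlonglongrightarrow> (\<Sum>k<5. (- y) ^ k * (if k = 0 then 1 else 0))"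
    unfolding ifac_sum_def
  proof (intro tendsto_sum tendsto_mult tendsto_const)
    fix k :: nat assume "k \<in> {..<5}"
    then have "k \<in> {0, 1, 2, 3, 4}" by auto
    then show "(\<lambda>n. ifac k n) \<longlonglongrightarrow> (if k = 0 then 1 else 0)"
      by (elim insertE emptyE; simp only: ifac_values; simp; real_asymp)
  qed
  have R0: "(\<lambda>n. R q n) \<longlonglongrightarrow> 0"
  proof (rule tendsto_sandwich[OF _ _ tendsto_const zn])
    show "eventually (\<lambda>n. 0 \<le> R q n) sequentially" "eventually (\<lambda>n. R q n \<le> z ^ n) sequentially"
      using R_bounds[OF q] unfolding z_def eventually_sequentially by blast+
  qed
  have f0: "f \<longlonglongrightarrow> 0"
    unfolding f_def using tendsto_diff[OF R0 tendsto_divide[OF bounded[OF S] tendsto_const[of "1 - 2 * q"]]] q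
    by simp
  have "(\<lambda>n. 1 / real n ^ 5) \<longlonglongrightarrow> 0" by real_asymp
  from bounded[OF this] have G0: "G \<longlonglongrightarrow> 0" by (simp add: G_def)
  \<comment> \<open>Both \<open>cbin n\<close> and \<open>1 / n ^ 5\<close> decrease, and
    \<open>z ^ n\<close> contributes the factor \<open>z < 1\<close>.\<close>
  have Gdiff: "(1 - z) * G n \<le> G n - G (Suc n)" if n: "n \<ge> 1" for n
  proof -
    have "G (Suc n) \<le> z ^ Suc n * cbin n / real n ^ 5"
      unfolding G_def
    proof (intro frac_le mult_left_mono power_mono)
      show "cbin (Suc n) \<le> cbin n"
        unfolding cbin_Suc using cbin_pos[of n] by (simp add: divide_simps)
    qed (use n z cbin_pos[of n] in \<open>auto simp: less_imp_le\<close>)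
    also have "\<dots> = z * G n" by (simp add: G_def)
    finally show ?thesis by (simp add: left_diff_distrib)
  qed
  have Gpos: "G n \<ge> 0" for n unfolding G_def using z cbin_pos[of n] by simp
  have fdiff: "f n - f (Suc n) = z ^ n * cbin n * (D * ifac 5 n)" if n: "n \<ge> 1" for n
  proof -
    have "f n - f (Suc n) = z ^ n * cbin n * ((1 - 2 * q) - ifac_sum y 5 n / (1 - 2 * q)
        + z * ((2 * real n + 1) / (2 * real n + 2)) * ifac_sum y 5 (Suc n) / (1 - 2 * q))"
      using R_Suc[OF n, of q] unfolding f_def cbin_Suc z_def[symmetric]
      by (simp add: ring_distribs mult_ac)
    also have "(1 - 2 * q) - ifac_sum y 5 n / (1 - 2 * q)
        + z * ((2 * real n + 1) / (2 * real n + 2)) * ifac_sum y 5 (Suc n) / (1 - 2 * q)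
      = (1 - 2 * q) * (1 - (1 + y) * ifac_sum y 5 n
        + y * ((2 * real n + 1) / (2 * real n + 2)) * ifac_sum y 5 (Suc n))"
    \<comment> \<open>By \<open>yz\<close>, dividing by \<open>(1 - 2 * q) ^ 2\<close> produces the
      coefficients \<open>1 + y\<close> and \<open>y\<close>. Only the coefficient \<open>y\<close>
      is rewritten, not the argument of \<open>ifac_sum\<close>.\<close>
    proof -
      have *: "d - s / d + z * r * s' / d = d * (1 - 1 / d ^ 2 * s + z / d ^ 2 * r * s')"
        if "d \<noteq> 0" for d s r s' :: real
        using that by (simp add: field_simps power2_eq_square)
      show ?thesis unfolding yz(1) by (subst (3) yz(2)) (rule *, use q in auto)
    qed
    finally show ?thesis unfolding ifac_sum_defect D_def by simp
  qed
  have "(\<lambda>n. z ^ n * cbin n * (D * ifac 5 n)) \<in> O(\<lambda>n. z ^ n * cbin n * (1 / real n ^ 5))"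
    using ifac5 by (intro landau_o.big.mult_left) simp
  then have "(\<lambda>n. f n - f (Suc n)) \<in> O(G)"
    unfolding G_def using fdiff
    by (subst landau_o.big.in_cong[where g = "\<lambda>n. z ^ n * cbin n * (D * ifac 5 n)"])
      (auto simp: eventually_sequentially)
  also have "G \<in> O(\<lambda>n. G n - G (Suc n))"
  proof (rule landau_o.bigI[of "1 / (1 - z)"])
    show "eventually (\<lambda>n. norm (G n) \<le> 1 / (1 - z) * norm (G n - G (Suc n))) sequentially"
      using eventually_ge_at_top[of 1]
    proof eventually_elim
      case (elim n)
      have "0 \<le> (1 - z) * G n" using z Gpos[of n] by simp
      with Gdiff[OF elim] Gpos[of n] z show ?case by (simp add: field_simps)
    qed
  qed (use z in auto)
  finally have fG: "f \<in> O(G)"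
  proof (intro bigo_from_differences[OF f0 G0])
    show "eventually (\<lambda>n. G (Suc n) \<le> G n) sequentially"
      using eventually_ge_at_top[of 1]
    proof eventually_elim
      case (elim n)
      have "0 \<le> (1 - z) * G n" using z Gpos[of n] by simp
      with Gdiff[OF elim] show ?case by simp
    qed
  qed
  have nz: "z ^ n * cbin n \<noteq> 0" for n using z cbin_pos[of n] by simp
  have "(\<lambda>n. (1 - 2 * q) / (z ^ n * cbin n) * f n) \<in> O(\<lambda>n. (1 - 2 * q) / (z ^ n * cbin n) * G n)"
    by (rule landau_o.big.mult_left[OF fG])
  moreover have "(1 - 2 * q) / (z ^ n * cbin n) * f n
      = R q n * (1 - 2 * q) / (z ^ n * cbin n) - ifac_sum y 5 n" for n
  proof -
    have *: "d / c * (x - c * s / d) = x * d / c - s" if "c \<noteq> 0" "d \<noteq> 0" for c d x s :: real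
      using that by (simp add: field_simps)
    show ?thesis unfolding f_def by (rule *) (use nz[of n] q in auto)
  qed
  moreover have "(1 - 2 * q) / (z ^ n * cbin n) * G n = (1 - 2 * q) * (1 / real n ^ 5)" for n
    using nz[of n] by (simp add: G_def)
  moreover have "O(\<lambda>n. (1 - 2 * q) * (1 / real n ^ 5)) = O(\<lambda>n. 1 / real n ^ 5)"
    by (rule landau_o.big.cmult) (use q in simp)
  ultimately show ?thesis by (simp only:)
qed

section \<open>From inverse factorials to powers of \<open>1 / n\<close>\<close>

definition ifac_poly :: "real \<Rightarrow> real poly" where
  "ifac_poly y = [:1, - y / 2, y / 2 + 3 / 4 * y ^ 2, - (y / 2) - 9 / 4 * y ^ 2 - 15 / 8 * y ^ 3,
     y / 2 + 21 / 4 * y ^ 2 + 45 / 4 * y ^ 3 + 105 / 16 * y ^ 4:]"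

text \<open>Expanding each \<open>1 / (n + j)\<close> geometrically gives, up to sign and the factor
  \<open>pochhammer (1 / 2) k\<close>, Stirling numbers of the second kind as coefficients.\<close>

lemma ifac_expansion:
  "(\<lambda>n. ifac 1 n - poly [:0, 1 / 2, - 1 / 2, 1 / 2, - 1 / 2:] (1 / real n)) \<in> O(\<lambda>n. 1 / real n ^ 5)"
  "(\<lambda>n. ifac 2 n - poly [:0, 0, 3 / 4, - 9 / 4, 21 / 4:] (1 / real n)) \<in> O(\<lambda>n. 1 / real n ^ 5)"
  "(\<lambda>n. ifac 3 n - poly [:0, 0, 0, 15 / 8, - 45 / 4:] (1 / real n)) \<in> O(\<lambda>n. 1 / real n ^ 5)"
  "(\<lambda>n. ifac 4 n - poly [:0, 0, 0, 0, 105 / 16:] (1 / real n)) \<in> O(\<lambda>n. 1 / real n ^ 5)"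
  unfolding ifac_values poly_pCons poly_0 by real_asymp+

lemma ifac_sum_expansion:
  "(\<lambda>n. ifac_sum y 5 n - poly (ifac_poly y) (1 / real n)) \<in> O(\<lambda>n. 1 / real n ^ 5)"
proof -
  define p1 p2 p3 p4 :: "real poly" where p_def: "p1 = [:0, 1 / 2, - 1 / 2, 1 / 2, - 1 / 2:]"
    "p2 = [:0, 0, 3 / 4, - 9 / 4, 21 / 4:]" "p3 = [:0, 0, 0, 15 / 8, - 45 / 4:]" "p4 = [:0, 0, 0, 0, 105 / 16:]"
  have bigo_scaled: "(\<lambda>n. c * h n) \<in> O(g)" if "h \<in> O(g)" for c and h g :: "nat \<Rightarrow> real"
    using that by (cases "c = 0") auto
  have T: "(\<lambda>n. (- y) * (ifac 1 n - poly p1 (1 / real n)) + y ^ 2 * (ifac 2 n - poly p2 (1 / real n))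
      + (- (y ^ 3)) * (ifac 3 n - poly p3 (1 / real n)) + y ^ 4 * (ifac 4 n - poly p4 (1 / real n)))
      \<in> O(\<lambda>n. 1 / real n ^ 5)"
    unfolding p_def by (intro sum_in_bigo bigo_scaled ifac_expansion)
  have S: "ifac_sum y 5 n = 1 - y * ifac 1 n + y ^ 2 * ifac 2 n - y ^ 3 * ifac 3 n + y ^ 4 * ifac 4 n" for n
    by (simp add: ifac_sum_def ifac_def[of 0] eval_nat_numeral)
  have P: "ifac_poly y = 1 - smult y p1 + smult (y ^ 2) p2 - smult (y ^ 3) p3 + smult (y ^ 4) p4"
    by (simp add: ifac_poly_def p_def one_pCons)
  have "(- y) * (ifac 1 n - poly p1 (1 / real n)) + y ^ 2 * (ifac 2 n - poly p2 (1 / real n))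
      + (- (y ^ 3)) * (ifac 3 n - poly p3 (1 / real n)) + y ^ 4 * (ifac 4 n - poly p4 (1 / real n))
      = ifac_sum y 5 n - poly (ifac_poly y) (1 / real n)" for n
    unfolding S P by (simp add: algebra_simps)
  with T show ?thesis by (simp only:)
qed

text \<open>The stated coefficients are the Cauchy product of the two expansions through degree
  4.\<close>

lemma coeffs_product:
  assumes "q \<noteq> 1 / 2"
  defines "y \<equiv> 4 * q * (1 - q) / (1 - 2 * q) ^ 2"
  obtains r where "\<And>x. poly stirling_poly x * poly (ifac_poly y) x
      = poly [:1, c1 q, c2 q, c3 q, c4 q:] x + x ^ 5 * poly r x"
proof -
  \<comment> \<open>In terms of \<open>d\<close> every coefficient is rational with a power of
    \<open>d\<close> as denominator, so clearing it leaves polynomial identities.\<close>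
  define d where "d = 2 * q - 1"
  have d: "d \<noteq> 0" and q: "q = (1 + d) / 2" using assms by (auto simp: d_def field_simps)
  have y: "y = (1 - d ^ 2) / d ^ 2"
  proof -
    have "4 * q * (1 - q) = 1 - d ^ 2" "(1 - 2 * q) ^ 2 = d ^ 2"
      by (simp_all add: q power2_eq_square field_simps)
    then show ?thesis by (simp add: y_def)
  qed
  define b1 b2 b3 b4 where b_def: "b1 = - y / 2" "b2 = y / 2 + 3 / 4 * y ^ 2"
    "b3 = - (y / 2) - 9 / 4 * y ^ 2 - 15 / 8 * y ^ 3"
    "b4 = y / 2 + 21 / 4 * y ^ 2 + 45 / 4 * y ^ 3 + 105 / 16 * y ^ 4"
  define a1 a2 a3 a4 :: real where a_def: "a1 = - 1 / 8" "a2 = 1 / 128" "a3 = 5 / 1024" "a4 = - 21 / 32768"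
  have c1: "c1 q = b1 + a1"
    unfolding c1_def a_def b_def y q using d by (simp add: divide_simps) algebra
  have c2: "c2 q = b2 + a1 * b1 + a2"
    unfolding c2_def a_def b_def y q using d by (simp add: divide_simps) algebra
  have c3: "c3 q = b3 + a1 * b2 + a2 * b1 + a3"
    unfolding c3_def a_def b_def y q using d by (simp add: divide_simps) algebra
  have c4: "c4 q = b4 + a1 * b3 + a2 * b2 + a3 * b1 + a4"
    unfolding c4_def a_def b_def y q using d by (simp add: divide_simps) algebra
  show thesis
  proof (rule that)
    fix x
    \<comment> \<open>The witness collects the product coefficients of degrees 5 to 8.\<close>
    show "poly stirling_poly x * poly (ifac_poly y) x
      = poly [:1, c1 q, c2 q, c3 q, c4 q:] x + x ^ 5 * poly
        [:a1 * b4 + a2 * b3 + a3 * b2 + a4 * b1, a2 * b4 + a3 * b3 + a4 * b2, a3 * b4 + a4 * b3, a4 * b4:] x"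
      unfolding c1 c2 c3 c4 stirling_poly_def ifac_poly_def a_def[symmetric] b_def[symmetric] poly_pCons poly_0
      by algebra
  qed
qed

section \<open>Product of the two expansions\<close>

theorem theorem2:
  fixes q :: real
  assumes "0 < q" and "q < 1 / 2"
  shows "\<exists>E :: nat \<Rightarrow> real. E \<in> O(\<lambda>n. 1 / real n ^ 5) \<and>
    (\<forall>n\<ge>1. R q n = (4 * q * (1 - q)) ^ n / (sqrt pi * (1 - 2 * q)) * (1 / sqrt (real n)) *
      (1 + c1 q / real n + c2 q / real n ^ 2 + c3 q / real n ^ 3 + c4 q / real n ^ 4 + E n))"
proof -
  define z where "z = 4 * q * (1 - q)"
  define y where "y = 4 * q * (1 - q) / (1 - 2 * q) ^ 2"
  define C where "C = [:1, c1 q, c2 q, c3 q, c4 q:]"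
  define A where "A = (\<lambda>n. poly stirling_poly (1 / real n))"
  define B where "B = (\<lambda>n. poly (ifac_poly y) (1 / real n))"
  define u where "u = (\<lambda>n. cbin n * sqrt (pi * real n))"
  define v where "v = (\<lambda>n. R q n * (1 - 2 * q) / (z ^ n * cbin n))"
  \<comment> \<open>With \<open>E\<close> the exact remainder the equation holds for every
    \<open>n \<ge> 1\<close>, since \<open>z ^ n * cbin n\<close> cancels in
    \<open>u n * v n\<close>; the work lies in bounding \<open>E\<close>.\<close>
  define E where "E = (\<lambda>n. u n * v n - poly C (1 / real n))"
  obtain r where r: "\<And>x. poly stirling_poly x * poly (ifac_poly y) x = poly C x + x ^ 5 * poly r x"
    using coeffs_product[of q] assms unfolding C_def y_def by auto
  have uA: "(\<lambda>n. u n - A n) \<in> O(\<lambda>n. 1 / real n ^ 5)"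
    unfolding u_def A_def by (rule cbin_expansion)
  have vB: "(\<lambda>n. v n - B n) \<in> O(\<lambda>n. 1 / real n ^ 5)"
    using sum_in_bigo(1)[OF R_ifac_expansion[OF assms] ifac_sum_expansion[of y]]
    unfolding v_def B_def y_def z_def by simp
  have B1: "B \<in> O(\<lambda>_. 1)"
    unfolding B_def by (rule poly_inverse_nat_bigo)
  have "u \<in> O(\<lambda>_. 1)"
    unfolding u_def using cbin_sqrt_tendsto by (intro bigoI_tendsto[where c = 1]) auto
  then have "(\<lambda>n. u n * (v n - B n)) \<in> O(\<lambda>n. 1 / real n ^ 5)"
    using landau_o.big.mult[OF _ vB, of u "\<lambda>_. 1"] by simp
  moreover have "(\<lambda>n. (u n - A n) * B n) \<in> O(\<lambda>n. 1 / real n ^ 5)"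
    using landau_o.big.mult[OF uA B1] by simp
  \<comment> \<open>This splits \<open>u n * v n - A n * B n\<close> and adds the terms of
    \<open>A n * B n\<close> beyond degree 4.\<close>
  ultimately have "(\<lambda>n. u n * (v n - B n) + (u n - A n) * B n + (1 / real n) ^ 5 * poly r (1 / real n))
      \<in> O(\<lambda>n. 1 / real n ^ 5)"
    by (intro sum_in_bigo poly_inverse_nat_bigo_pow)
  moreover have "u n * (v n - B n) + (u n - A n) * B n + (1 / real n) ^ 5 * poly r (1 / real n) = E n" for n
    using r[of "1 / real n"] unfolding E_def A_def B_def by (simp add: algebra_simps)
  ultimately have "E \<in> O(\<lambda>n. 1 / real n ^ 5)" by simp
  moreover have "R q n = (4 * q * (1 - q)) ^ n / (sqrt pi * (1 - 2 * q)) * (1 / sqrt (real n)) *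
      (1 + c1 q / real n + c2 q / real n ^ 2 + c3 q / real n ^ 3 + c4 q / real n ^ 4 + E n)"
    if n: "n \<ge> 1" for n
  proof -
    have "1 + c1 q / real n + c2 q / real n ^ 2 + c3 q / real n ^ 3 + c4 q / real n ^ 4 = poly C (1 / real n)"
      unfolding C_def using n by (simp add: field_simps eval_nat_numeral)
    then have "1 + c1 q / real n + c2 q / real n ^ 2 + c3 q / real n ^ 3 + c4 q / real n ^ 4 + E n = u n * v n"
      by (simp add: E_def)
    moreover have "z > 0" using assms by (simp add: z_def)
    ultimately show ?thesis
      unfolding z_def[symmetric] u_def v_def using assms n cbin_pos[of n]
      by (simp add: real_sqrt_mult)
  qed
  ultimately show ?thesis by blast
qed

end
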